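(* Let $H$ be a graph reproducing kernel Hilbert space (GRKHS) of graph signals, with inner product $\langle\cdot,\cdot\rangle_H$. Then $H$ is a shift-invariant GRKHS (SIGRKHS) if and only if there exist GRKHSs $H_m\subset W_m$ with inner products $\langle\cdot,\cdot\rangle_{H_m}$, $1\le m\le M$, such that $$H=\bigoplus_{m=1}^M H_m$$ and $$\langle\mathbf{x},\mathbf{y}\rangle_H=\sum_{m=1}^M\langle\widehat{\mathbf{x}}(m),\widehat{\mathbf{y}}(m)\rangle_{H_m}\quad\text{for all}\ \mathbf{x},\mathbf{y}\in H.$$
   Context: Let $\mathcal{G}=(V,E,\mathbf{W})$ be a finite, simple, undirected graph with $N\ge 2$ vertices. A graph signal is a vector $\mathbf{x}=[x(v)]_{v\in V}\in\mathbb{R}^V$. A graph shift is a matrix $\mathbf{S}=[s(i,j)]_{i,j\in V}$ with $s(i,j)=0$ unless $i=j$ or $(i,j)\in E$. Standing assumption: $\mathbf{S}_1,\ldots,\mathbf{S}_d$ are graph shifts that are real-valued, symmetric and pairwise commuting. Choose an orthogonal matrix $\mathbf{U}=[\mathbf{u}_1,\ldots,\mathbf{u}_N]$ with $\mathbf{S}_l=\sum_{n=1}^N\lambda_l(n)\mathbf{u}_n\mathbf{u}_n^T$ for $1\le l\le d$, and set $\boldsymbol{\lambda}(n)=[\lambda_1(n),\ldots,\lambda_d(n)]^T\in\mathbb{R}^d$. Let $\boldsymbol{\gamma}(m)=[\gamma_1(m),\ldots,\gamma_d(m)]^T$, $1\le m\le M$, be the distinct elements of $\{\boldsymbol{\lambda}(n):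 1\le n\le N\}$. Put $\mathbf{P}_m=\sum_{\boldsymbol{\lambda}(n)=\boldsymbol{\gamma}(m)}\mathbf{u}_n\mathbf{u}_n^T$ (independent of the choice of $\mathbf{U}$), $W_m=\mathbf{P}_m\mathbb{R}^V=\bigcap_{l=1}^d\ker(\mathbf{S}_l-\gamma_l(m)\mathbf{I})$, and $\widehat{\mathbf{x}}(m)=\mathbf{P}_m\mathbf{x}$ for $\mathbf{x}\in\mathbb{R}^V$. A GRKHS is a Hilbert space $H$ of graph signals (a linear subspace of $\mathbb{R}^V$ with an inner product $\langle\cdot,\cdot\rangle_H$ and norm $\|\cdot\|_H$) such that for every $v\in V$ there is a constant $C_v>0$ with $|x(v)|\le C_v\|\mathbf{x}\|_H$ for all $\mathbf{x}\in H$. Its reproducing kernel is the matrix $\mathbf{K}=[K(v,v')]_{v,v'\in V}$ whose columns $K(\cdot,v)$ lie in $H$ and satisfy $x(v)=\langle\mathbf{x},K(\cdot,v)\rangle_H$ for all $\mathbf{x}\in H$, $v\in V$; one has $H=\{\mathbf{K}\mathbf{c}:\mathbf{c}\in\mathbb{R}^V\}$. An SIGRKHS is a GRKHS whose reproducing kernel satisfies $\mathbf{K}\mathbf{S}_l=\mathbf{S}_l\mathbf{K}$ for all $1\le l\le d$. *)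

theory Defs
  imports "HOL-Analysis.Analysis"
begin

text \<open>
  The vertex set of a graph is the whole finite type \<open>'v\<close>, so graph signals are vectors
  in \<open>real ^ 'v\<close>. The weight matrix is part of the data but is left unconstrained.
\<close>

record ('v::finite) weighted_graph =
  edges :: "('v \<times> 'v) set"
  weights :: "real ^ 'v ^ 'v"

definition simple_undirected :: "('v::finite) weighted_graph \<Rightarrow> bool" where
  "simple_undirected G \<longleftrightarrow> sym (edges G) \<and> irrefl (edges G)"

definition graph_shift :: "('v::finite) weighted_graph \<Rightarrow> real ^ 'v ^ 'v \<Rightarrow> bool" where
  "graph_shift G S \<longleftrightarrow> (\<forall>i j. S $ i $ j \<noteq> 0 \<longrightarrow> i = j \<or> (i, j) \<in> edges G)"

definition outer_prod :: "real ^ 'v \<Rightarrow> real ^ 'v \<Rightarrow> real ^ 'v ^ 'v" where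
  "outer_prod x y = (\<chi> i j. x $ i * y $ j)"

text \<open>
  An orthonormal basis of \<open>real ^ 'v\<close> has as many members as there are vertices, so the
  type \<open>'v\<close> also serves to index the columns of the matrix \<open>U\<close> of joint eigenvectors. The vector
  \<open>lam n\<close> collects the eigenvalues of all the shifts at the \<open>n\<close>-th column.
\<close>

definition joint_diagonalization ::
  "('d::finite \<Rightarrow> real ^ 'v ^ 'v) \<Rightarrow> real ^ 'v ^ 'v \<Rightarrow> ('v::finite \<Rightarrow> real ^ 'd) \<Rightarrow> bool" where
  "joint_diagonalization S U lam \<longleftrightarrow>
     orthogonal_matrix U \<and>
     (\<forall>l. S l = (\<Sum>n\<in>UNIV. (lam n $ l) *\<^sub>R outer_prod (column n U) (column n U)))"

definition spectral_proj ::
  "real ^ 'v ^ 'v \<Rightarrow> ('v::finite \<Rightarrow> real ^ 'd) \<Rightarrow> real ^ 'd \<Rightarrow> real ^ 'v ^ 'v" where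
  "spectral_proj U lam g = (\<Sum>n | lam n = g. outer_prod (column n U) (column n U))"

definition spectral_space ::
  "real ^ 'v ^ 'v \<Rightarrow> ('v::finite \<Rightarrow> real ^ 'd) \<Rightarrow> real ^ 'd \<Rightarrow> (real ^ 'v) set" where
  "spectral_space U lam g = range (\<lambda>x. spectral_proj U lam g *v x)"

text \<open>
  A Hilbert space of signals is a carrier \<open>H\<close> together with a function \<open>ip\<close>; only the values of
  \<open>ip\<close> on \<open>H\<close> are meaningful.
\<close>

definition inner_product_on :: "'a::real_vector set \<Rightarrow> ('a \<Rightarrow> 'a \<Rightarrow> real) \<Rightarrow> bool" where
  "inner_product_on H ip \<longleftrightarrow>
     (\<forall>x\<in>H. \<forall>y\<in>H. ip x y = ip y x) \<and>
     (\<forall>x\<in>H. \<forall>y\<in>H. \<forall>z\<in>H. ip (x + y) z = ip x z + ip y z) \<and>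
     (\<forall>a. \<forall>x\<in>H. \<forall>y\<in>H. ip (a *\<^sub>R x) y = a * ip x y) \<and>
     (\<forall>x\<in>H. x \<noteq> 0 \<longrightarrow> ip x x > 0)"

definition ip_norm :: "('a \<Rightarrow> 'a \<Rightarrow> real) \<Rightarrow> 'a \<Rightarrow> real" where
  "ip_norm ip x = sqrt (ip x x)"

definition complete_on :: "'a::real_vector set \<Rightarrow> ('a \<Rightarrow> 'a \<Rightarrow> real) \<Rightarrow> bool" where
  "complete_on H ip \<longleftrightarrow>
     (\<forall>X. (\<forall>n::nat. X n \<in> H) \<and>
          (\<forall>e>0. \<exists>N. \<forall>m\<ge>N. \<forall>n\<ge>N. ip_norm ip (X m - X n) < e)
       \<longrightarrow> (\<exists>L\<in>H. (\<lambda>n. ip_norm ip (X n - L)) \<longlonglongrightarrow> 0))"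

definition hilbert_space_on :: "'a::real_vector set \<Rightarrow> ('a \<Rightarrow> 'a \<Rightarrow> real) \<Rightarrow> bool" where
  "hilbert_space_on H ip \<longleftrightarrow> subspace H \<and> inner_product_on H ip \<and> complete_on H ip"

definition GRKHS :: "(real ^ 'v) set \<Rightarrow> (real ^ 'v \<Rightarrow> real ^ 'v \<Rightarrow> real) \<Rightarrow> bool" where
  "GRKHS H ip \<longleftrightarrow>
     hilbert_space_on H ip \<and> (\<forall>v. \<exists>C>0. \<forall>x\<in>H. \<bar>x $ v\<bar> \<le> C * ip_norm ip x)"

definition reproducing_kernel ::
  "(real ^ 'v) set \<Rightarrow> (real ^ 'v \<Rightarrow> real ^ 'v \<Rightarrow> real) \<Rightarrow> real ^ 'v ^ 'v \<Rightarrow> bool" where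
  "reproducing_kernel H ip K \<longleftrightarrow>
     (\<forall>v. column v K \<in> H \<and> (\<forall>x\<in>H. x $ v = ip x (column v K)))"

text \<open>The reproducing kernel of a GRKHS exists and is unique.\<close>

definition SIGRKHS ::
  "('d \<Rightarrow> real ^ 'v ^ 'v) \<Rightarrow> (real ^ 'v) set \<Rightarrow> (real ^ 'v \<Rightarrow> real ^ 'v \<Rightarrow> real) \<Rightarrow> bool" where
  "SIGRKHS S H ip \<longleftrightarrow>
     GRKHS H ip \<and> (\<exists>K. reproducing_kernel H ip K \<and> (\<forall>l. K ** S l = S l ** K))"

text \<open>
  The sum map is a bijection onto \<open>H\<close>: sums of members of the summands range exactly over \<open>H\<close>,
  and every member of \<open>H\<close> has only one such decomposition.
\<close>

definition is_direct_sum :: "'a::real_vector set \<Rightarrow> 'i set \<Rightarrow> ('i \<Rightarrow> 'a set) \<Rightarrow> bool" where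
  "is_direct_sum H I F \<longleftrightarrow> bij_betw (\<lambda>f. \<Sum>i\<in>I. f i) (Pi\<^sub>E I F) H"

end

theory Submission
  imports Defs
begin

text \<open>
  If the reproducing kernel \<open>K\<close> of \<open>H\<close> commutes with the shifts, it commutes with the spectral
  projections \<open>P m\<close>. As \<open>H\<close> is the range of \<open>K\<close> and the inner product of \<open>x\<close> with \<open>K *v c\<close> is
  the Euclidean \<open>x \<bullet> c\<close>, each \<open>P m\<close> maps \<open>H\<close> into itself and is self-adjoint for the inner product
  of \<open>H\<close>; hence \<open>H\<close> is the orthogonal sum of the \<open>P m ` H\<close>. Conversely, the sum of the kernels of
  the summands reproduces \<open>H\<close>, and it commutes with each \<open>P m\<close> because \<open>P m\<close> sends it to the
  \<open>m\<close>-th kernel, which is symmetric.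
\<close>

section \<open>Inner products on subspaces\<close>

lemma inner_product_onD:
  assumes "inner_product_on H ip"
  shows inner_product_on_sym: "\<And>x y. x \<in> H \<Longrightarrow> y \<in> H \<Longrightarrow> ip x y = ip y x"
    and inner_product_on_add: "\<And>x y z. x \<in> H \<Longrightarrow> y \<in> H \<Longrightarrow> z \<in> H \<Longrightarrow> ip (x + y) z = ip x z + ip y z"
    and inner_product_on_scale: "\<And>a x y. x \<in> H \<Longrightarrow> y \<in> H \<Longrightarrow> ip (a *\<^sub>R x) y = a * ip x y"
    and inner_product_on_pos: "\<And>x. x \<in> H \<Longrightarrow> x \<noteq> 0 \<Longrightarrow> ip x x > 0"
  using assms by (simp_all add: inner_product_on_def)

lemma inner_product_on_subset:
  "inner_product_on H ip \<Longrightarrow> F \<subseteq> H \<Longrightarrow> inner_product_on F ip"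
  unfolding inner_product_on_def by (meson subsetD)

lemma inner_product_on_add_right:
  assumes "inner_product_on H ip" "subspace H" "x \<in> H" "y \<in> H" "z \<in> H"
  shows "ip x (y + z) = ip x y + ip x z"
  using inner_product_on_add[OF assms(1,4,5,3)] inner_product_on_sym[OF assms(1)]
    subspace_add[OF assms(2,4,5)] assms(3-5) by simp

lemma inner_product_on_scale_right:
  assumes "inner_product_on H ip" "subspace H" "x \<in> H" "y \<in> H"
  shows "ip x (a *\<^sub>R y) = a * ip x y"
  using inner_product_on_scale[OF assms(1,4,3)] inner_product_on_sym[OF assms(1)]
    subspace_scale[OF assms(2,4)] assms(3,4) by simp

lemma inner_product_on_diff:
  assumes "inner_product_on H ip" "subspace H" "x \<in> H" "y \<in> H" "z \<in> H"
  shows "ip (x - y) z = ip x z - ip y z"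
  using inner_product_on_add[OF assms(1) subspace_diff[OF assms(2,3,4)] assms(4,5)] by simp

lemma inner_product_on_sum_right:
  assumes ip: "inner_product_on H ip" and H: "subspace H" and x: "x \<in> H"
    and "finite A" "\<And>a. a \<in> A \<Longrightarrow> f a \<in> H"
  shows "ip x (\<Sum>a\<in>A. f a) = (\<Sum>a\<in>A. ip x (f a))"
  using assms(4,5)
proof (induction A rule: finite_induct)
  case empty
  have "ip x (0 *\<^sub>R x) = 0 * ip x x"
    by (rule inner_product_on_scale_right[OF ip H x x])
  then show ?case by simp
next
  case (insert a A)
  then show ?case
    by (simp add: inner_product_on_add_right[OF ip H x] subspace_sum[OF H])
qed

text \<open>A Gram-Schmidt argument by induction on a generating set, which may be linearly
  dependent. \<open>f\<close> stays arbitrary because the induction hypothesis is applied to two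
  different functionals.\<close>

lemma riesz_span:
  fixes X :: "'a::real_vector set"
  assumes "finite X" and "inner_product_on (span X) ip"
    and "\<And>x y. x \<in> span X \<Longrightarrow> y \<in> span X \<Longrightarrow> f (x + y) = f x + f y"
    and "\<And>a x. x \<in> span X \<Longrightarrow> f (a *\<^sub>R x) = a * (f x :: real)"
  shows "\<exists>z\<in>span X. \<forall>x\<in>span X. ip x z = f x"
  using assms
proof (induction X arbitrary: f rule: finite_induct)
  case empty
  have "ip 0 0 = 0"
    using inner_product_on_scale[OF empty.prems(1), of 0 0 0] by simp
  moreover have "f 0 = 0"
    using empty.prems(3)[of 0 0] by simp
  ultimately show ?case by simp
next
  case (insert a X)
  let ?S = "span X" and ?T = "span (insert a X)"
  note ip = insert.prems(1)
  have sub: "x \<in> ?T" if "x \<in> ?S" for x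
    using that span_mono[of X "insert a X"] by blast
  have aT: "a \<in> ?T" by (simp add: span_base)
  have ipS: "inner_product_on ?S ip"
    using ip sub inner_product_on_subset by blast
  \<comment> \<open>Representing the functional \<open>ip x a\<close> of \<open>x\<close> inside
    \<open>?S\<close> yields \<open>p\<close>, the orthogonal projection of \<open>a\<close> onto
    \<open>?S\<close> with respect to \<open>ip\<close>.\<close>
  have "\<exists>p\<in>?S. \<forall>x\<in>?S. ip x p = ip x a"
    by (rule insert.IH[OF ipS])
      (use sub aT in \<open>simp_all add: inner_product_on_add[OF ip] inner_product_on_scale[OF ip]\<close>)
  then obtain p where p: "p \<in> ?S" and ipp: "\<And>x. x \<in> ?S \<Longrightarrow> ip x p = ip x a" by blast
  obtain z where z: "z \<in> ?S" and ipz: "\<And>x. x \<in> ?S \<Longrightarrow> ip x z = f x"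
    using insert.IH[OF ipS, of f] insert.prems(2,3)[OF sub] sub by auto
  define r where "r = a - p"
  have rT: "r \<in> ?T" using aT sub[OF p] by (simp add: r_def span_diff)
  have orth: "ip x r = 0" if "x \<in> ?S" for x
  proof -
    have "ip r x = ip a x - ip p x"
      unfolding r_def by (rule inner_product_on_diff[OF ip subspace_span aT sub[OF p] sub[OF that]])
    also have "\<dots> = 0"
      using ipp[OF that] inner_product_on_sym[OF ip sub[OF that] aT]
        inner_product_on_sym[OF ip sub[OF that] sub[OF p]] by simp
    finally show ?thesis
      using inner_product_on_sym[OF ip sub[OF that] rT] by simp
  qed
  have decomp: "\<exists>k s. s \<in> ?S \<and> x = s + k *\<^sub>R r" if x: "x \<in> ?T" for x
  proof -
    obtain k where "x - k *\<^sub>R a \<in> ?S" using x span_breakdown_eq by blast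
    then have "(x - k *\<^sub>R a) + k *\<^sub>R p \<in> ?S"
      using p by (simp add: span_add span_scale)
    moreover have "x = ((x - k *\<^sub>R a) + k *\<^sub>R p) + k *\<^sub>R r"
      by (simp add: r_def algebra_simps)
    ultimately show ?thesis by blast
  qed
  \<comment> \<open>If \<open>r = 0\<close>, the quotient is a division by zero, but then it multiplies the zero vector.\<close>
  define w where "w = z + (f r / ip r r) *\<^sub>R r"
  have wT: "w \<in> ?T" using sub[OF z] rT by (simp add: w_def span_add span_scale)
  have zero: "f 0 = 0" "ip 0 y = 0" if "y \<in> ?T" for y
    using insert.prems(3)[of a 0] inner_product_on_scale[OF ip aT that, of 0] aT by simp_all
  have ipr: "ip r w = f r"
  proof (cases "r = 0")
    case True
    then show ?thesis using zero wT by simp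
  next
    case False
    have "ip r z = 0" using orth[OF z] inner_product_on_sym[OF ip rT sub[OF z]] by simp
    then have "ip r w = f r / ip r r * ip r r"
      unfolding w_def using rT sub z
      by (simp add: inner_product_on_add_right[OF ip subspace_span] span_scale
          inner_product_on_scale_right[OF ip subspace_span])
    then show ?thesis using inner_product_on_pos[OF ip rT False] by simp
  qed
  have "ip x w = f x" if x: "x \<in> ?T" for x
  proof -
    obtain k s where s: "s \<in> ?S" and xs: "x = s + k *\<^sub>R r" using decomp[OF x] by blast
    \<comment> \<open>The correction added to \<open>z\<close> is orthogonal to \<open>?S\<close>,
      so \<open>w\<close> still represents \<open>f\<close> there; \<open>ipr\<close> settles the
      remaining direction \<open>r\<close>.\<close>
    have "ip s w = f s"
      unfolding w_def using rT sub z s orth ipz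
      by (simp add: inner_product_on_add_right[OF ip subspace_span] span_scale
          inner_product_on_scale_right[OF ip subspace_span])
    then show ?thesis
      unfolding xs using rT sub[OF s] wT ipr insert.prems(2,3)
      by (simp add: inner_product_on_add[OF ip] inner_product_on_scale[OF ip] span_scale)
  qed
  then show ?case using wT by blast
qed

text \<open>A finite basis of \<open>H\<close> reduces this to \<open>riesz_span\<close>. It
  supplies both the columns of reproducing kernels and orthogonal projections with respect to
  \<open>ip\<close>.\<close>

lemma riesz_subspace:
  fixes H :: "'a::euclidean_space set"
  assumes H: "subspace H" and ip: "inner_product_on H ip"
    and "\<And>x y. x \<in> H \<Longrightarrow> y \<in> H \<Longrightarrow> f (x + y) = f x + f y"
    and "\<And>a x. x \<in> H \<Longrightarrow> f (a *\<^sub>R x) = a * (f x :: real)"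
  obtains z where "z \<in> H" "\<And>x. x \<in> H \<Longrightarrow> ip x z = f x"
proof -
  obtain B where B: "B \<subseteq> H" "independent B" "H \<subseteq> span B" by (metis basis_exists)
  then have "finite B" and "span B = H"
    by (simp_all add: independent_imp_finite H subset_antisym span_minimal)
  then show ?thesis
    using riesz_span[of B ip f] ip assms(3,4) that by metis
qed

section \<open>Reproducing kernels\<close>

lemma GRKHS_D:
  assumes "GRKHS H ip"
  shows GRKHS_subspace: "subspace H" and GRKHS_inner_product: "inner_product_on H ip"
  using assms unfolding GRKHS_def hilbert_space_on_def by blast+

text \<open>Only completeness takes work: bounded point evaluations turn convergence in the norm of
  \<open>ip\<close> into coordinatewise, hence Euclidean, convergence, and a subspace of a
  finite-dimensional space is closed.\<close>

lemma GRKHS_mono: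
  assumes GR: "GRKHS H ip" and F: "subspace F" "F \<subseteq> H"
  shows "GRKHS F ip"
proof -
  have bnd: "\<exists>C>0. \<forall>x\<in>H. \<bar>x $ v\<bar> \<le> C * ip_norm ip x" for v
    using GR unfolding GRKHS_def by blast
  have "\<exists>L\<in>F. (\<lambda>n. ip_norm ip (X n - L)) \<longlonglongrightarrow> 0"
    if XF: "\<forall>n::nat. X n \<in> F"
      and Cau: "\<forall>e>0. \<exists>N. \<forall>m\<ge>N. \<forall>n\<ge>N. ip_norm ip (X m - X n) < e" for X
  proof -
    have "complete_on H ip" "\<forall>n. X n \<in> H"
      using GR XF F(2) unfolding GRKHS_def hilbert_space_on_def by blast+
    then obtain L where L: "L \<in> H" and lim: "(\<lambda>n. ip_norm ip (X n - L)) \<longlonglongrightarrow> 0"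
      using Cau unfolding complete_on_def by blast
    have "(\<lambda>n. X n $ v) \<longlonglongrightarrow> L $ v" for v
    proof -
      obtain C where C: "\<And>x. x \<in> H \<Longrightarrow> \<bar>x $ v\<bar> \<le> C * ip_norm ip x" using bnd by blast
      have "(\<lambda>n. X n $ v - L $ v) \<longlonglongrightarrow> 0"
      proof (rule Lim_null_comparison)
        show "\<forall>\<^sub>F n in sequentially. norm (X n $ v - L $ v) \<le> C * ip_norm ip (X n - L)"
        proof (rule always_eventually, rule allI)
          fix n
          have "X n - L \<in> H" using XF F(2) L GRKHS_subspace[OF GR] subspace_diff by blast
          then show "norm (X n $ v - L $ v) \<le> C * ip_norm ip (X n - L)" using C by fastforce
        qed
        show "(\<lambda>n. C * ip_norm ip (X n - L)) \<longlonglongrightarrow> 0"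
          using tendsto_mult_right_zero[OF lim] .
      qed
      then show ?thesis by (rule LIM_zero_cancel)
    qed
    then have "X \<longlonglongrightarrow> L" by (rule vec_tendstoI)
    then have "L \<in> F" using XF closed_subspace[OF F(1)] closed_sequentially by blast
    then show ?thesis using lim by blast
  qed
  then have "complete_on F ip" unfolding complete_on_def by blast
  then show ?thesis
    using bnd F inner_product_on_subset[OF GRKHS_inner_product[OF GR] F(2)]
    unfolding GRKHS_def hilbert_space_on_def by blast
qed

text \<open>Column \<open>v\<close> is the Riesz representer of evaluation at
  \<open>v\<close>.\<close>

lemma reproducing_kernel_exists:
  assumes "GRKHS H ip"
  shows "\<exists>K. reproducing_kernel H ip K"
proof -
  have "\<exists>z. z \<in> H \<and> (\<forall>x\<in>H. x $ v = ip x z)" for v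
    by (rule riesz_subspace[OF GRKHS_subspace[OF assms] GRKHS_inner_product[OF assms], of "\<lambda>x. x $ v"])
      auto
  then obtain k where k: "\<And>v. k v \<in> H" "\<And>v x. x \<in> H \<Longrightarrow> x $ v = ip x (k v)" by metis
  have "column v (\<chi> i j. k j $ i) = k v" for v by (simp add: column_def vec_eq_iff)
  then show ?thesis unfolding reproducing_kernel_def using k by metis
qed

text \<open>Each entry of \<open>K\<close> is the inner product of two of its columns, by
  reproduction applied to a column.\<close>

lemma reproducing_kernel_symmetric:
  assumes "inner_product_on H ip" "reproducing_kernel H ip K"
  shows "transpose K = K"
proof -
  have "K $ i $ j = ip (column j K) (column i K)" for i j
    using assms(2) unfolding reproducing_kernel_def by (metis column_def vec_lambda_beta)
  then show ?thesis
    using assms by (simp add: transpose_def vec_eq_iff reproducing_kernel_def inner_product_on_sym)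
qed

text \<open>\<open>K *v c\<close> is a linear combination of columns of \<open>K\<close>, so both
  claims follow from the columns by linearity. The second one trades \<open>ip\<close> for the
  Euclidean product.\<close>

lemma
  assumes "subspace H" "inner_product_on H ip" and K: "reproducing_kernel H ip K"
  shows reproducing_kernel_mult_in: "K *v c \<in> H"
    and ip_reproducing_kernel: "x \<in> H \<Longrightarrow> ip x (K *v c) = x \<bullet> c"
proof -
  have Kc: "K *v c = (\<Sum>v\<in>UNIV. c $ v *\<^sub>R column v K)"
    by (simp add: matrix_mult_sum scalar_mult_eq_scaleR)
  have col: "column v K \<in> H" for v using K unfolding reproducing_kernel_def by blast
  show "K *v c \<in> H" unfolding Kc using assms(1) col by (simp add: subspace_sum subspace_scale)
  assume x: "x \<in> H"
  show "ip x (K *v c) = x \<bullet> c"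
    unfolding Kc using K x col assms(1,2)
    by (simp add: inner_product_on_sum_right subspace_scale inner_product_on_scale_right
        reproducing_kernel_def inner_vec_def mult.commute)
qed

text \<open>The residual of projecting a member of \<open>H\<close> onto the range is orthogonal to
  every column of \<open>K\<close>, so by reproduction it vanishes at every vertex.\<close>

lemma reproducing_kernel_range:
  assumes H: "subspace H" and ip: "inner_product_on H ip" and K: "reproducing_kernel H ip K"
  shows "range ((*v) K) = H"
proof (intro subset_antisym subsetI)
  let ?R = "range ((*v) K)"
  note inH = reproducing_kernel_mult_in[OF assms]
  fix x assume x: "x \<in> H"
  have R: "subspace ?R" by (simp add: linear_subspace_image)
  have RH: "?R \<subseteq> H" using inH by blast
  \<comment> \<open>\<open>p\<close> is the orthogonal projection of \<open>x\<close> onto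
    \<open>?R\<close>, obtained as the representer of \<open>ip y x\<close> as a functional of
    \<open>y\<close> in \<open>?R\<close>.\<close>
  obtain p where p: "p \<in> ?R" and ipp: "\<And>y. y \<in> ?R \<Longrightarrow> ip y p = ip y x"
    by (rule riesz_subspace[OF R inner_product_on_subset[OF ip RH], of "\<lambda>y. ip y x"])
      (use RH x inH in \<open>auto simp: inner_product_on_add[OF ip] inner_product_on_scale[OF ip]\<close>)
  have pH: "p \<in> H" using p RH by blast
  have "(x - p) $ v = 0" for v
  proof -
    have col: "column v K \<in> ?R" by (metis matrix_vector_mult_basis rangeI)
    have "(x - p) $ v = ip (x - p) (column v K)"
      using K subspace_diff[OF H x pH] unfolding reproducing_kernel_def by blast
    also have "\<dots> = ip x (column v K) - ip p (column v K)"
      using inner_product_on_diff[OF ip H x pH] col RH by blast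
    also have "\<dots> = 0"
      using ipp[OF col] inner_product_on_sym[OF ip] x pH col RH by (metis eq_iff_diff_eq_0 subsetD)
    finally show ?thesis .
  qed
  then have "x = p" by (simp add: vec_eq_iff)
  then show "x \<in> ?R" using p by simp
qed (use reproducing_kernel_mult_in[OF assms] in blast)

section \<open>Orthogonal resolutions of the identity\<close>

lemma matrix_mul_sum_right:
  fixes A :: "real ^ 'n ^ 'm" and B :: "'i \<Rightarrow> real ^ 'p ^ 'n"
  shows "A ** (\<Sum>i\<in>I. B i) = (\<Sum>i\<in>I. A ** B i)"
  by (induction I rule: infinite_finite_induct)
    (simp_all add: matrix_add_ldistrib)

lemma matrix_mul_sum_left:
  fixes A :: "real ^ 'n ^ 'p" and B :: "'i \<Rightarrow> real ^ 'p ^ 'n"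
  shows "(\<Sum>i\<in>I. B i) ** A = (\<Sum>i\<in>I. B i ** A)"
  by (induction I rule: infinite_finite_induct)
    (simp_all add: matrix_matrix_mult_def vec_eq_iff distrib_right sum.distrib)

lemma matrix_sum_vector:
  fixes B :: "'i \<Rightarrow> real ^ 'n ^ 'm"
  shows "(\<Sum>i\<in>I. B i) *v x = (\<Sum>i\<in>I. B i *v x)"
  by (induction I rule: infinite_finite_induct) (simp_all add: matrix_vector_mult_add_rdistrib)

lemma matrix_mul_scaleR:
  fixes A :: "real ^ 'n ^ 'm" and B :: "real ^ 'p ^ 'n"
  shows "(a *\<^sub>R A) ** B = a *\<^sub>R (A ** B)" and "A ** (a *\<^sub>R B) = a *\<^sub>R (A ** B)"
  by (simp_all add: matrix_matrix_mult_def vec_eq_iff sum_distrib_left mult_ac)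

lemma column_matrix_mul: "column v (A ** B) = A *v column v B"
  by (simp add: column_def vec_eq_iff matrix_matrix_mult_def matrix_vector_mult_def)

text \<open>Abstracts the family of spectral projections; within the locale, joint eigenvalues
  appear only as the parameter \<open>g\<close> of \<open>commute_P\<close>.\<close>

locale orthogonal_resolution =
  fixes I :: "'i set" and P :: "'i \<Rightarrow> real ^ 'v ^ 'v"
  assumes finite_I: "finite I"
    and P_sym: "i \<in> I \<Longrightarrow> transpose (P i) = P i"
    and P_mul: "i \<in> I \<Longrightarrow> j \<in> I \<Longrightarrow> P i ** P j = (if i = j then P i else 0)"
    and P_sum: "(\<Sum>i\<in>I. P i) = mat 1"
begin

lemma P_P: "i \<in> I \<Longrightarrow> j \<in> I \<Longrightarrow> P i *v (P j *v x) = (if i = j then P i *v x else 0)"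
  by (simp add: matrix_vector_mul_assoc P_mul)

lemma P_sum_vec: "(\<Sum>i\<in>I. P i *v x) = x"
  using P_sum by (metis matrix_sum_vector matrix_vector_mul_lid)

text \<open>\<open>P i\<close> fixes its own range and annihilates the ranges of the others, so it
  recovers the \<open>i\<close>-th summand. This inverts the sum map of a direct sum.\<close>

lemma P_sum_of_parts:
  assumes "i \<in> I" "\<And>j. j \<in> I \<Longrightarrow> f j \<in> range ((*v) (P j))"
  shows "P i *v (\<Sum>j\<in>I. f j) = f i"
proof -
  have "P i *v f j = (if i = j then f j else 0)" if j: "j \<in> I" for j
  proof -
    obtain x where "f j = P j *v x" using assms(2)[OF j] by blast
    then show ?thesis using P_P[OF assms(1) j] by (auto simp: matrix_vector_mul_assoc)
  qed
  then show ?thesis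
    using assms(1) finite_I by (simp add: linear_sum[OF matrix_vector_mul_linear])
qed

text \<open>
  Moving \<open>S l\<close> through \<open>P i ** K ** P j\<close> gives \<open>(g i l - g j l) *\<^sub>R (P i ** K ** P j) = 0\<close>,
  so \<open>K\<close> is block diagonal.
\<close>

lemma commute_P:
  fixes S :: "'d \<Rightarrow> real ^ 'v ^ 'v" and g :: "'i \<Rightarrow> 'd \<Rightarrow> real"
  assumes S: "\<And>l. S l = (\<Sum>i\<in>I. g i l *\<^sub>R P i)" and inj: "inj_on g I"
    and K: "\<And>l. K ** S l = S l ** K" and i: "i \<in> I"
  shows "K ** P i = P i ** K"
proof -
  have PS: "P i ** S l = g i l *\<^sub>R P i" "S l ** P i = g i l *\<^sub>R P i" if "i \<in> I" for i l
  proof -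
    have "P i ** S l = (\<Sum>j\<in>I. if i = j then g i l *\<^sub>R P i else 0)"
      unfolding S matrix_mul_sum_right using that P_mul
      by (intro sum.cong) (auto simp: matrix_mul_scaleR)
    then show "P i ** S l = g i l *\<^sub>R P i" using that finite_I by simp
    have "S l ** P i = (\<Sum>j\<in>I. if i = j then g i l *\<^sub>R P i else 0)"
      unfolding S matrix_mul_sum_left using that P_mul
      by (intro sum.cong) (auto simp: matrix_mul_scaleR)
    then show "S l ** P i = g i l *\<^sub>R P i" using that finite_I by simp
  qed
  have off: "P i ** K ** P j = 0" if ij: "i \<in> I" "j \<in> I" "i \<noteq> j" for i j
  proof -
    \<comment> \<open>Distinct joint eigenvalues may agree for some shifts; \<open>l\<close> is one
      at which they differ.\<close>
    obtain l where l: "g i l \<noteq> g j l" using inj ij by (meson ext inj_onD)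
    have "g i l *\<^sub>R (P i ** K ** P j) = P i ** S l ** K ** P j"
      by (simp add: PS ij matrix_mul_scaleR)
    also have "\<dots> = P i ** K ** (S l ** P j)"
      by (metis K matrix_mul_assoc)
    also have "\<dots> = g j l *\<^sub>R (P i ** K ** P j)"
      by (simp add: PS ij matrix_mul_scaleR)
    finally show ?thesis using l by simp
  qed
  \<comment> \<open>Inserting the identity on either side of the product leaves only the diagonal
    block \<open>P i ** K ** P i\<close>.\<close>
  have "P i ** K = P i ** K ** (\<Sum>j\<in>I. P j)" by (simp add: P_sum)
  also have "\<dots> = (\<Sum>j\<in>I. if j = i then P i ** K ** P i else 0)"
    unfolding matrix_mul_sum_right using off i by (intro sum.cong) auto
  also have "\<dots> = P i ** K ** P i" using i finite_I by simp
  finally have 1: "P i ** K = P i ** K ** P i" .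
  have "K ** P i = (\<Sum>j\<in>I. P j) ** (K ** P i)" by (simp add: P_sum)
  also have "\<dots> = (\<Sum>j\<in>I. if j = i then P i ** K ** P i else 0)"
    unfolding matrix_mul_sum_left using off i by (intro sum.cong) (auto simp: matrix_mul_assoc)
  also have "\<dots> = P i ** K ** P i" using i finite_I by simp
  finally show ?thesis using 1 by simp
qed

text \<open>Every summand carries the restriction of \<open>ip\<close> itself, so one inner product
  serves for all \<open>i\<close>.\<close>

lemma direct_sum_of_commuting_kernel:
  assumes GR: "GRKHS H ip" and K: "reproducing_kernel H ip K"
    and comm: "\<And>i. i \<in> I \<Longrightarrow> K ** P i = P i ** K"
  defines "F \<equiv> \<lambda>i. (*v) (P i) ` H"
  shows "i \<in> I \<Longrightarrow> GRKHS (F i) ip"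
    and "is_direct_sum H I F"
    and "\<lbrakk>x \<in> H; y \<in> H\<rbrakk> \<Longrightarrow> ip x y = (\<Sum>i\<in>I. ip (P i *v x) (P i *v y))"
proof -
  note H = GRKHS_subspace[OF GR] and ip = GRKHS_inner_product[OF GR]
  note ranK = reproducing_kernel_range[OF H ip K]
  have PH: "P i *v x \<in> H" if "i \<in> I" and x: "x \<in> H" for i x
  proof -
    \<comment> \<open>Commutation lets \<open>P i\<close> act on the coefficient vector
      \<open>c\<close> instead, which keeps the result in the range of \<open>K\<close>.\<close>
    obtain c where "x = K *v c" using ranK x by blast
    then have "P i *v x = K *v (P i *v c)"
      using comm[OF \<open>i \<in> I\<close>] by (simp add: matrix_vector_mul_assoc)
    then show ?thesis using ranK by blast
  qed
  show "GRKHS (F i) ip" if "i \<in> I" for i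
  proof (rule GRKHS_mono[OF GR])
    show "subspace (F i)" unfolding F_def using H by (simp add: linear_subspace_image)
    show "F i \<subseteq> H" unfolding F_def using PH that by blast
  qed
  show "is_direct_sum H I F"
    unfolding is_direct_sum_def
  \<comment> \<open>The inverse sends \<open>x\<close> to its family of components, restricted to
    \<open>I\<close> because members of \<open>Pi\<^sub>E I F\<close> are \<open>undefined\<close>
    elsewhere.\<close>
  proof (rule bij_betw_byWitness[where f' = "\<lambda>x. \<lambda>i\<in>I. P i *v x"])
    show "\<forall>f\<in>Pi\<^sub>E I F. (\<lambda>i\<in>I. P i *v (\<Sum>j\<in>I. f j)) = f"
    proof
      fix f assume f: "f \<in> Pi\<^sub>E I F"
      then have "f j \<in> range ((*v) (P j))" if "j \<in> I" for j
        using that unfolding F_def by (auto simp: PiE_iff)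
      then show "(\<lambda>i\<in>I. P i *v (\<Sum>j\<in>I. f j)) = f"
        using P_sum_of_parts f by (auto simp: restrict_def PiE_iff extensional_def)
    qed
    show "\<forall>x\<in>H. (\<Sum>i\<in>I. (\<lambda>i\<in>I. P i *v x) i) = x"
      by (simp add: P_sum_vec)
    show "(\<lambda>f. \<Sum>i\<in>I. f i) ` Pi\<^sub>E I F \<subseteq> H"
    proof (rule image_subsetI)
      fix f assume f: "f \<in> Pi\<^sub>E I F"
      have "f i \<in> H" if "i \<in> I" for i
        using PiE_mem[OF f that] PH[OF that] unfolding F_def by auto
      then show "(\<Sum>i\<in>I. f i) \<in> H" by (rule subspace_sum[OF H])
    qed
    show "(\<lambda>x. \<lambda>i\<in>I. P i *v x) ` H \<subseteq> Pi\<^sub>E I F"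
      by (auto simp: F_def)
  qed
  \<comment> \<open>Writing \<open>y\<close> as \<open>K *v c\<close> passes to the Euclidean
    product, where \<open>P i\<close> is symmetric; commutation with \<open>K\<close> leads back to
    \<open>ip\<close>.\<close>
  have adj: "ip (P i *v x) y = ip x (P i *v y)" if i: "i \<in> I" and x: "x \<in> H" and y: "y \<in> H" for i x y
  proof -
    obtain c where c: "y = K *v c" using ranK y by blast
    have "ip (P i *v x) y = (P i *v x) \<bullet> c"
      unfolding c by (rule ip_reproducing_kernel[OF H ip K PH[OF i x]])
    also have "\<dots> = x \<bullet> (P i *v c)"
      using P_sym[OF i] by (metis dot_lmul_matrix vector_transpose_matrix)
    also have "\<dots> = ip x (K *v (P i *v c))"
      by (rule ip_reproducing_kernel[OF H ip K x, symmetric])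
    also have "K *v (P i *v c) = P i *v y"
      using comm[OF i] by (simp add: c matrix_vector_mul_assoc)
    finally show ?thesis .
  qed
  show "ip x y = (\<Sum>i\<in>I. ip (P i *v x) (P i *v y))" if x: "x \<in> H" and y: "y \<in> H"
  proof -
    have "ip x y = ip x (\<Sum>i\<in>I. P i *v y)" by (simp add: P_sum_vec)
    also have "\<dots> = (\<Sum>i\<in>I. ip x (P i *v y))"
      by (rule inner_product_on_sum_right[OF ip H x finite_I PH[OF _ y]])
    \<comment> \<open>Self-adjointness moves the first \<open>P i\<close> to the right, where
      idempotence absorbs it.\<close>
    also have "\<dots> = (\<Sum>i\<in>I. ip (P i *v x) (P i *v y))"
      using adj x PH y by (intro sum.cong) (simp_all add: P_P)
    finally show ?thesis .
  qed
qed

text \<open>\<open>P i\<close> sends column \<open>v\<close> of the summed kernel to column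
  \<open>v\<close> of \<open>k i\<close>. The pairing with \<open>x\<close> thus becomes the sum of
  the values of \<open>P i *v x\<close> at \<open>v\<close>, which is the value of \<open>x\<close>
  there.\<close>

lemma commuting_kernel_of_direct_sum:
  assumes GR: "\<And>i. i \<in> I \<Longrightarrow> GRKHS (F i) (ips i)"
    and sub: "\<And>i. i \<in> I \<Longrightarrow> F i \<subseteq> range ((*v) (P i))"
    and dsum: "is_direct_sum H I F"
    and ip: "\<And>x y. \<lbrakk>x \<in> H; y \<in> H\<rbrakk> \<Longrightarrow> ip x y = (\<Sum>i\<in>I. ips i (P i *v x) (P i *v y))"
  shows "\<exists>K. reproducing_kernel H ip K \<and> (\<forall>i\<in>I. K ** P i = P i ** K)"
proof -
  have "\<forall>i. \<exists>K. i \<in> I \<longrightarrow> reproducing_kernel (F i) (ips i) K"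
    using reproducing_kernel_exists GR by blast
  then obtain k where k: "\<And>i. i \<in> I \<Longrightarrow> reproducing_kernel (F i) (ips i) (k i)" by metis
  define K where "K = (\<Sum>i\<in>I. k i)"
  have kF: "column v (k i) \<in> F i" if "i \<in> I" for i v
    using k[OF that] unfolding reproducing_kernel_def by blast
  have colK: "column v K = (\<Sum>i\<in>I. column v (k i))" for v
    unfolding K_def by (simp add: vec_eq_iff column_def)
  have H: "H = (\<lambda>f. \<Sum>i\<in>I. f i) ` Pi\<^sub>E I F"
    using dsum unfolding is_direct_sum_def bij_betw_def by simp
  have colH: "column v K \<in> H" for v
  proof -
    have "column v K = (\<Sum>i\<in>I. (\<lambda>i\<in>I. column v (k i)) i)" by (simp add: colK)
    moreover have "(\<lambda>i\<in>I. column v (k i)) \<in> Pi\<^sub>E I F" using kF by auto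
    ultimately show ?thesis unfolding H by blast
  qed
  have Pcol: "P i *v column v K = column v (k i)" if "i \<in> I" for i v
    unfolding colK by (rule P_sum_of_parts) (use that kF sub in blast)+
  have PF: "P i *v x \<in> F i" if i: "i \<in> I" and x: "x \<in> H" for i x
  proof -
    obtain f where f: "f \<in> Pi\<^sub>E I F" and xf: "x = (\<Sum>i\<in>I. f i)" using x H by blast
    have "P i *v x = f i"
      unfolding xf by (rule P_sum_of_parts[OF i]) (use f sub in \<open>auto simp: PiE_iff\<close>)
    then show ?thesis using f i by auto
  qed
  have "reproducing_kernel H ip K"
    unfolding reproducing_kernel_def
  proof (intro allI conjI ballI)
    fix v x assume x: "x \<in> H"
    have "ip x (column v K) = (\<Sum>i\<in>I. ips i (P i *v x) (column v (k i)))"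
      using ip[OF x colH] Pcol by simp
    also have "\<dots> = (\<Sum>i\<in>I. (P i *v x) $ v)"
      using k PF[OF _ x] unfolding reproducing_kernel_def by (intro sum.cong) simp_all
    also have "\<dots> = x $ v" by (metis P_sum_vec sum_component)
    finally show "x $ v = ip x (column v K)" by simp
  qed (rule colH)
  moreover have "K ** P i = P i ** K" if i: "i \<in> I" for i
  proof -
    have PK: "P i ** K = k i"
    proof -
      have "column v (P i ** K) = column v (k i)" for v
        by (simp add: column_matrix_mul Pcol[OF i])
      then show ?thesis by (simp add: column_def vec_eq_iff)
    qed
    have ksym: "transpose (k j) = k j" if "j \<in> I" for j
      using reproducing_kernel_symmetric[OF GRKHS_inner_product[OF GR[OF that]] k[OF that]] .
    have "transpose K = (\<Sum>j\<in>I. transpose (k j))"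
      unfolding K_def by (simp add: transpose_def vec_eq_iff)
    then have "transpose K = K" using ksym by (simp add: K_def)
    \<comment> \<open>Since \<open>K\<close> and \<open>P i\<close> are symmetric, transposing swaps
      the order of the product; the product \<open>k i\<close> is itself symmetric, so nothing
      changes.\<close>
    then have "K ** P i = transpose (P i ** K)"
      using P_sym[OF i] by (simp add: matrix_transpose_mul)
    then show ?thesis using PK ksym[OF i] by simp
  qed
  ultimately show ?thesis by blast
qed

end

section \<open>Spectral projections of commuting shifts\<close>

lemma outer_prod_mul: "outer_prod a b ** outer_prod c d = (b \<bullet> c) *\<^sub>R outer_prod a d"
  by (simp add: outer_prod_def matrix_matrix_mult_def vec_eq_iff inner_vec_def sum_distrib_left mult_ac)

lemma column_orthogonal_matrix:
  fixes U :: "real ^ 'v ^ 'v"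
  assumes "orthogonal_matrix U"
  shows "column m U \<bullet> column n U = (if m = n then 1 else 0)"
proof -
  have "(transpose U ** U) $ m $ n = (mat 1 :: real ^ 'v ^ 'v) $ m $ n"
    using assms unfolding orthogonal_matrix_def by simp
  then show ?thesis
    by (simp add: matrix_matrix_mult_def transpose_def mat_def inner_vec_def column_def)
qed

lemma sum_outer_prod_columns:
  fixes U :: "real ^ 'v ^ 'v"
  assumes "orthogonal_matrix U"
  shows "(\<Sum>n\<in>UNIV. outer_prod (column n U) (column n U)) = mat 1"
proof -
  have "(\<Sum>n\<in>UNIV. outer_prod (column n U) (column n U)) = U ** transpose U"
    by (simp add: vec_eq_iff outer_prod_def column_def matrix_matrix_mult_def transpose_def)
  then show ?thesis using assms unfolding orthogonal_matrix_def by simp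
qed

text \<open>\<open>gam\<close> lists every value of \<open>lam\<close> exactly once, so each column
  index falls into exactly one fibre.\<close>

lemma sum_over_fibres:
  fixes lam :: "'v::finite \<Rightarrow> 'c"
  assumes "bij_betw gam I (range lam)" "finite I"
  shows "(\<Sum>i\<in>I. \<Sum>n | lam n = gam i. f n) = (\<Sum>n\<in>UNIV. f n)"
proof -
  have "(\<Sum>i\<in>I. \<Sum>n | lam n = gam i. f n) = (\<Sum>c\<in>range lam. \<Sum>n | lam n = c. f n)"
    by (rule sum.reindex_bij_betw[OF assms(1)])
  also have "\<dots> = (\<Sum>n\<in>UNIV. f n)"
    using sum.group[of UNIV "range lam" lam f] by simp
  finally show ?thesis .
qed

text \<open>The columns of \<open>U\<close> are orthonormal, so their outer products are mutually
  orthogonal projections summing to the identity; grouping them by joint eigenvalue preserves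
  this.\<close>

lemma spectral_resolution:
  assumes U: "orthogonal_matrix U" and gam: "bij_betw gam I (range lam)" and fin: "finite I"
  shows "orthogonal_resolution I (\<lambda>i. spectral_proj U lam (gam i))"
proof
  fix i j assume i: "i \<in> I" and j: "j \<in> I"
  let ?E = "\<lambda>n. outer_prod (column n U) (column n U)"
  have E: "?E m ** ?E n = (if m = n then ?E m else 0)" for m n
    by (simp add: outer_prod_mul column_orthogonal_matrix[OF U])
  have "spectral_proj U lam (gam i) ** spectral_proj U lam (gam j)
      = (\<Sum>m | lam m = gam i. \<Sum>n | lam n = gam j. if m = n then ?E m else 0)"
    unfolding spectral_proj_def matrix_mul_sum_left unfolding matrix_mul_sum_right E ..
  \<comment> \<open>For \<open>m\<close> in the fibre of \<open>gam i\<close>, the inner sum meets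
    \<open>n = m\<close> exactly when the two fibres coincide.\<close>
  also have "\<dots> = (\<Sum>m | lam m = gam i. if gam i = gam j then ?E m else 0)"
    by (intro sum.cong) auto
  also have "\<dots> = (if gam i = gam j then spectral_proj U lam (gam i) else 0)"
    by (simp add: spectral_proj_def)
  also have "gam i = gam j \<longleftrightarrow> i = j"
    using gam i j unfolding bij_betw_def by (auto dest: inj_onD)
  finally show "spectral_proj U lam (gam i) ** spectral_proj U lam (gam j)
      = (if i = j then spectral_proj U lam (gam i) else 0)" .
next
  show "(\<Sum>i\<in>I. spectral_proj U lam (gam i)) = mat 1"
    unfolding spectral_proj_def sum_over_fibres[OF gam fin] by (rule sum_outer_prod_columns[OF U])
next
  fix i
  show "transpose (spectral_proj U lam (gam i)) = spectral_proj U lam (gam i)"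
    by (simp add: spectral_proj_def transpose_def vec_eq_iff outer_prod_def mult.commute)
qed (rule fin)

text \<open>The eigenvalue is constant on each fibre and factors out, giving the form that
  \<open>commute_P\<close> expects.\<close>

lemma shift_spectral_sum:
  assumes "joint_diagonalization S U lam" and gam: "bij_betw gam I (range lam)" and fin: "finite I"
  shows "S l = (\<Sum>i\<in>I. (gam i $ l) *\<^sub>R spectral_proj U lam (gam i))"
proof -
  have "S l = (\<Sum>i\<in>I. \<Sum>n | lam n = gam i. (lam n $ l) *\<^sub>R outer_prod (column n U) (column n U))"
    using assms(1) unfolding joint_diagonalization_def sum_over_fibres[OF gam fin] by blast
  also have "\<dots> = (\<Sum>i\<in>I. (gam i $ l) *\<^sub>R spectral_proj U lam (gam i))"
    by (simp add: spectral_proj_def scaleR_sum_right)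
  finally show ?thesis .
qed

section \<open>Shift invariance and the spectral decomposition of \<open>H\<close>\<close>

theorem theorem5p3:
  fixes G :: "('v::finite) weighted_graph"
    and S :: "'d::finite \<Rightarrow> real ^ 'v ^ 'v"
    and U :: "real ^ 'v ^ 'v"
    and lam :: "'v \<Rightarrow> real ^ 'd"
    and M :: nat
    and gam :: "nat \<Rightarrow> real ^ 'd"
    and H :: "(real ^ 'v) set"
    and ip :: "real ^ 'v \<Rightarrow> real ^ 'v \<Rightarrow> real"
  assumes "CARD('v) \<ge> 2"
    and "simple_undirected G"
    and "\<And>l. graph_shift G (S l)"
    and "\<And>l. transpose (S l) = S l"
    and "\<And>k l. S k ** S l = S l ** S k"
    and "joint_diagonalization S U lam"
    and "bij_betw gam {1..M} (range lam)"
    and "GRKHS H ip"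
  shows "SIGRKHS S H ip \<longleftrightarrow>
    (\<exists>(Hs :: nat \<Rightarrow> (real ^ 'v) set) (ips :: nat \<Rightarrow> real ^ 'v \<Rightarrow> real ^ 'v \<Rightarrow> real).
       (\<forall>m\<in>{1..M}. GRKHS (Hs m) (ips m) \<and> Hs m \<subseteq> spectral_space U lam (gam m)) \<and>
       is_direct_sum H {1..M} Hs \<and>
       (\<forall>x\<in>H. \<forall>y\<in>H. ip x y = (\<Sum>m=1..M.
          ips m (spectral_proj U lam (gam m) *v x) (spectral_proj U lam (gam m) *v y))))"
    (is "_ \<longleftrightarrow> ?decomposition")
proof -
  note jd = assms(6) and gam = assms(7) and GR = assms(8)
  let ?P = "\<lambda>m. spectral_proj U lam (gam m)"
  interpret orthogonal_resolution "{1..M}" ?P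
    using jd gam by (intro spectral_resolution) (auto simp: joint_diagonalization_def)
  have S: "S l = (\<Sum>m=1..M. (gam m $ l) *\<^sub>R ?P m)" for l
    by (rule shift_spectral_sum[OF jd gam]) simp
  \<comment> \<open>Distinct eigenvalue vectors are distinct as functions of the shift index, which
    is how \<open>commute_P\<close> separates blocks.\<close>
  have inj: "inj_on (\<lambda>m l. gam m $ l) {1..M}"
    using gam unfolding bij_betw_def inj_on_def by (metis vec_eq_iff)
  show ?thesis
  proof
    assume "SIGRKHS S H ip"
    then obtain K where K: "reproducing_kernel H ip K" and KS: "\<And>l. K ** S l = S l ** K"
      unfolding SIGRKHS_def by blast
    note D = direct_sum_of_commuting_kernel[OF GR K commute_P[OF S inj KS]]
    have "(*v) (?P m) ` H \<subseteq> spectral_space U lam (gam m)" for m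
      unfolding spectral_space_def by blast
    then show ?decomposition
      by (intro exI[of _ "\<lambda>m. (*v) (?P m) ` H"] exI[of _ "\<lambda>_. ip"] conjI ballI D)
  next
    assume ?decomposition
    then obtain Hs ips where
      Hs: "\<forall>m\<in>{1..M}. GRKHS (Hs m) (ips m) \<and> Hs m \<subseteq> spectral_space U lam (gam m)"
      and dsum: "is_direct_sum H {1..M} Hs"
      and ips: "\<forall>x\<in>H. \<forall>y\<in>H. ip x y = (\<Sum>m=1..M. ips m (?P m *v x) (?P m *v y))"
      by (elim exE conjE)
    have GRm: "GRKHS (Hs m) (ips m)" and sub: "Hs m \<subseteq> range ((*v) (?P m))" if "m \<in> {1..M}" for m
      using bspec[OF Hs that] unfolding spectral_space_def by simp_all
    have "\<exists>K. reproducing_kernel H ip K \<and> (\<forall>m\<in>{1..M}. K ** ?P m = ?P m ** K)"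
      by (rule commuting_kernel_of_direct_sum[OF GRm sub dsum ips[rule_format]])
    then obtain K where K: "reproducing_kernel H ip K"
      and KP: "\<And>m. m \<in> {1..M} \<Longrightarrow> K ** ?P m = ?P m ** K"
      by blast
    \<comment> \<open>Each shift is a linear combination of the projections, so commutation extends
      to it by linearity.\<close>
    have "K ** S l = S l ** K" for l
      unfolding S using KP by (simp add: matrix_mul_sum_left matrix_mul_sum_right matrix_mul_scaleR)
    then show "SIGRKHS S H ip" unfolding SIGRKHS_def using GR K by blast
  qed
qed

end
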